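(* Let $S$ be a finite simplicial poset and $I\subseteq S$. Then $I$ is the independence poset of a matroid scheme on $S$ if and only if: (I1) $I$ is nonempty; (I2) if $x,y\in S$ with $x\le y$ and $y\in I$, then $x\in I$; (I3) if $x,y\in I$ and $|x|<|y|$, then there is $a\in\mathrm{at}(S)$ with $a\le y$, $a\not\le x$, and $a\vee x$ a nonempty subset of $I$; (I4) if $x,y\in S$, $z$ is a maximal element of $I_{\le x}=\{w\in I:w\le x\}$, and $z\le y$, then $x\vee y\ne\emptyset$.
   Context: A finite poset $S$ is a simplicial poset if it has a unique minimum $\hat 0$, is ranked, and each $S_{\le x}$ is isomorphic to the Boolean lattice of subsets of the set of atoms below $x$. $|x|$ is the rank of $x$, $\mathrm{at}(S)$ the set of atoms; $x\vee y$ (resp. $x\wedge y$) is the set of minimal common upper bounds (maximal common lower bounds) of $x,y$, and $x\wedge y$ also denotes its unique element when $x\vee y\neq\emptyset$. A matroid scheme on $S$ is a function $\rho:S\to\mathbb{Z}_{\ge0}$ with (M1) $0\le\rho(x)\le|x|$; (M2) $x\le y\Rightarrow\rho(x)\le\rho(y)$; (M3) $u\in x\vee y\Rightarrow\rho(x)+\rho(y)\ge\rho(u)+\rho(x\wedge y)$; (M4) $\ell\in x\wedge y$ and $\rho(x)=\rho(\ell)\Rightarrow x\vee y\ne\emptyset$; (M5) $\rho(x)<\rho(y)\Rightarrow$ there is an atom $a\le y$, $a\not\le x$, with $x\vee a\ne\emptyset$. Its independence poset is $\{x\in S:\rho(x)=|x|\}$. *)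

theory Defs
  imports Main
begin

text \<open>
  A poset is a carrier \<open>S\<close> with an order relation \<open>r\<close> such that \<^term>\<open>partial_order_on S r\<close>;
  \<open>(x, y) \<in> r\<close> means \<open>x \<le> y\<close>. By reflexivity \<open>Field r = S\<close>, so the auxiliary
  notions below take only \<open>r\<close> as an argument. The library sets \<^term>\<open>under r x\<close>,
  \<^term>\<open>Above r A\<close> and \<^term>\<open>Under r A\<close> are \<open>S\<close> restricted to the elements below \<open>x\<close>, the
  common upper bounds of \<open>A\<close>, and the common lower bounds of \<open>A\<close>.
\<close>

definition minimal_elems :: "'a rel \<Rightarrow> 'a set \<Rightarrow> 'a set"
  where "minimal_elems r A = {x \<in> A. \<forall>y\<in>A. (y, x) \<in> r \<longrightarrow> y = x}"

definition maximal_elems :: "'a rel \<Rightarrow> 'a set \<Rightarrow> 'a set"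
  where "maximal_elems r A = {x \<in> A. \<forall>y\<in>A. (x, y) \<in> r \<longrightarrow> y = x}"

definition joins :: "'a rel \<Rightarrow> 'a \<Rightarrow> 'a \<Rightarrow> 'a set"
  where "joins r x y = minimal_elems r (Above r {x, y})"

definition meets :: "'a rel \<Rightarrow> 'a \<Rightarrow> 'a \<Rightarrow> 'a set"
  where "meets r x y = maximal_elems r (Under r {x, y})"

definition is_minimum :: "'a rel \<Rightarrow> 'a \<Rightarrow> bool"
  where "is_minimum r z \<longleftrightarrow> z \<in> Field r \<and> (\<forall>x\<in>Field r. (z, x) \<in> r)"

definition atoms :: "'a rel \<Rightarrow> 'a set"
  where "atoms r = minimal_elems r {x \<in> Field r. \<not> is_minimum r x}"

definition maximal_chains :: "'a rel \<Rightarrow> 'a set \<Rightarrow> 'a set set"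
  where "maximal_chains r A =
    {C \<in> Chains r. C \<subseteq> A \<and> (\<forall>D\<in>Chains r. D \<subseteq> A \<and> C \<subseteq> D \<longrightarrow> D = C)}"

text \<open>Ranked: below each element, all maximal chains have the same length. No purity is
  required, i.e. different maximal elements may have different ranks.\<close>

definition ranked :: "'a rel \<Rightarrow> bool"
  where "ranked r \<longleftrightarrow>
    (\<forall>x\<in>Field r. \<forall>C\<in>maximal_chains r (under r x). \<forall>D\<in>maximal_chains r (under r x).
      card C = card D)"

text \<open>The length of a chain is one less than its number of elements.\<close>

definition rank :: "'a rel \<Rightarrow> 'a \<Rightarrow> nat"
  where "rank r x = Max (card ` maximal_chains r (under r x)) - 1"

definition simplicial_poset :: "'a set \<Rightarrow> 'a rel \<Rightarrow> bool"
  where "simplicial_poset S r \<longleftrightarrow>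
    partial_order_on S r \<and>
    (\<exists>!z. is_minimum r z) \<and>
    ranked r \<and>
    (\<forall>x\<in>S. \<exists>f. bij_betw f (under r x) (Pow (atoms r \<inter> under r x)) \<and>
      (\<forall>y\<in>under r x. \<forall>z\<in>under r x. (y, z) \<in> r \<longleftrightarrow> f y \<subseteq> f z))"

text \<open>If \<open>x\<close> and \<open>y\<close> have a common upper bound, they have exactly one maximal common lower bound,
  so \<open>the_elem\<close> in the third axiom below is well defined.\<close>

lemma meets_singleton:
  assumes S: "simplicial_poset S r" and "joins r x y \<noteq> {}"
  shows "\<exists>w. meets r x y = {w}"
proof -
  have po: "partial_order_on S r" using S by (simp add: simplicial_poset_def)
  have tr: "\<And>a b c. (a, b) \<in> r \<Longrightarrow> (b, c) \<in> r \<Longrightarrow> (a, c) \<in> r"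
    and sub: "r \<subseteq> S \<times> S"
    and anti: "\<And>a b. (a, b) \<in> r \<Longrightarrow> (b, a) \<in> r \<Longrightarrow> a = b"
    using partial_order_onD[OF po] by (auto dest: transD antisymD)
  obtain u where u: "(x, u) \<in> r" "(y, u) \<in> r" "u \<in> S"
    using assms(2) sub unfolding joins_def minimal_elems_def Above_def by auto
  obtain f where f: "bij_betw f (under r u) (Pow (atoms r \<inter> under r u))"
    and iso: "\<And>y z. y \<in> under r u \<Longrightarrow> z \<in> under r u \<Longrightarrow> (y, z) \<in> r \<longleftrightarrow> f y \<subseteq> f z"
    using S u(3) unfolding simplicial_poset_def by blast
  have xy: "x \<in> under r u" "y \<in> under r u" using u by (auto simp: under_def)
  have "f x \<inter> f y \<in> Pow (atoms r \<inter> under r u)"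
    using bij_betwE[OF f] xy by blast
  then obtain w where w: "w \<in> under r u" "f w = f x \<inter> f y"
    using f unfolding bij_betw_def by (metis imageE)
  have wl: "(w, x) \<in> r" "(w, y) \<in> r" using iso w xy by auto
  have gr: "(z, w) \<in> r" if "(z, x) \<in> r" "(z, y) \<in> r" for z
  proof -
    have "z \<in> under r u" using that u tr by (auto simp: under_def)
    then show ?thesis using iso that xy w by auto
  qed
  have "w \<in> Field r" using wl by (auto simp: Field_def)
  then have "meets r x y = {w}"
    using wl gr anti unfolding meets_def maximal_elems_def Under_def by blast
  then show ?thesis by blast
qed

definition matroid_scheme :: "'a set \<Rightarrow> 'a rel \<Rightarrow> ('a \<Rightarrow> nat) \<Rightarrow> bool"
  where "matroid_scheme S r \<rho> \<longleftrightarrow>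
    (\<forall>x\<in>S. 0 \<le> \<rho> x \<and> \<rho> x \<le> rank r x) \<and>
    (\<forall>x\<in>S. \<forall>y\<in>S. (x, y) \<in> r \<longrightarrow> \<rho> x \<le> \<rho> y) \<and>
    (\<forall>x\<in>S. \<forall>y\<in>S. \<forall>u\<in>joins r x y. \<rho> x + \<rho> y \<ge> \<rho> u + \<rho> (the_elem (meets r x y))) \<and>
    (\<forall>x\<in>S. \<forall>y\<in>S. \<forall>l\<in>meets r x y. \<rho> x = \<rho> l \<longrightarrow> joins r x y \<noteq> {}) \<and>
    (\<forall>x\<in>S. \<forall>y\<in>S. \<rho> x < \<rho> y \<longrightarrow>
      (\<exists>a\<in>atoms r. (a, y) \<in> r \<and> (a, x) \<notin> r \<and> joins r x a \<noteq> {}))"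

definition independence_poset :: "'a set \<Rightarrow> 'a rel \<Rightarrow> ('a \<Rightarrow> nat) \<Rightarrow> 'a set"
  where "independence_poset S r \<rho> = {x \<in> S. \<rho> x = rank r x}"

end

theory Submission
  imports Defs
begin

text \<open>
  Every interval below an element is the Boolean lattice of the atoms in it, so inside such an
  interval all classical matroid arguments are available.

  Given a matroid scheme, augmentation (I3) of \<open>x\<close> from \<open>y\<close> is obtained by applying (M5) not to
  \<open>x\<close> but to a maximal element \<open>x' \<ge> x\<close> of the same value: for the resulting atom \<open>a\<close>, a join
  \<open>v\<close> of \<open>a\<close> and \<open>x\<close> that does not raise the value would have a join with \<open>x'\<close> by (M4), and this
  join would contradict the maximality of \<open>x'\<close>. For (I4), a maximal independent element below
  \<open>x\<close> has the value of \<open>x\<close>, so (M4) applies.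

  Conversely, let \<open>\<rho> x\<close> be the largest rank of an element of \<open>I\<close> below \<open>x\<close>. By (I3) all maximal
  elements of \<open>I\<close> below \<open>x\<close> have rank \<open>\<rho> x\<close>; this gives (M3), and turns (I4) into (M4). An atom
  that augments a basis of \<open>x\<close> has a join with \<open>x\<close> by (I4), which is (M5).
\<close>

section \<open>Elements of a simplicial poset and their atom sets\<close>

locale finite_simplicial_poset =
  fixes S :: "'a set" and r :: "'a rel"
  assumes finite_carrier: "finite S" and simplicial: "simplicial_poset S r"
begin

abbreviation below :: "'a \<Rightarrow> 'a \<Rightarrow> bool" (infix "\<sqsubseteq>" 50)
  where "x \<sqsubseteq> y \<equiv> (x, y) \<in> r"

definition At :: "'a \<Rightarrow> 'a set"
  where "At x = atoms r \<inter> under r x"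

lemma partial_order: "partial_order_on S r"
  using simplicial by (simp add: simplicial_poset_def)

lemma below_refl: "x \<in> S \<Longrightarrow> x \<sqsubseteq> x"
  using partial_order_onD(1)[OF partial_order] by (auto dest: refl_onD)

lemma below_trans: "x \<sqsubseteq> y \<Longrightarrow> y \<sqsubseteq> z \<Longrightarrow> x \<sqsubseteq> z"
  using partial_order_onD(2)[OF partial_order] by (auto dest: transD)

lemma below_antisym: "x \<sqsubseteq> y \<Longrightarrow> y \<sqsubseteq> x \<Longrightarrow> x = y"
  using partial_order_onD(3)[OF partial_order] by (auto dest: antisymD)

lemma below_carrier: assumes "x \<sqsubseteq> y" shows "x \<in> S" "y \<in> S"
  using partial_order_onD(4)[OF partial_order] assms by auto

lemma Field_eq: "Field r = S"
  using below_refl below_carrier by (fastforce simp: Field_def)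

lemma finite_under: "finite (under r x)"
  by (rule finite_subset[OF _ finite_carrier]) (auto simp: under_def dest: below_carrier)

lemma finite_At: "finite (At x)"
  unfolding At_def using finite_under by blast

lemma mem_At: "a \<in> At x \<longleftrightarrow> a \<in> atoms r \<and> a \<sqsubseteq> x"
  by (simp add: At_def under_def)

lemma At_mono: "x \<sqsubseteq> y \<Longrightarrow> At x \<subseteq> At y"
  using below_trans by (auto simp: mem_At)

lemma At_atom: "a \<in> atoms r \<Longrightarrow> At a = {a}"
  using below_refl by (auto simp: mem_At atoms_def minimal_elems_def Field_eq)

lemma obtain_minimum: obtains z where "z \<in> S" "\<And>x. x \<in> S \<Longrightarrow> z \<sqsubseteq> x"
  using simplicial unfolding simplicial_poset_def is_minimum_def Field_eq by blast

lemma Boolean_interval: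
  assumes "u \<in> S"
  obtains f where "bij_betw f (under r u) (Pow (At u))"
    "\<And>y z. y \<sqsubseteq> u \<Longrightarrow> z \<sqsubseteq> u \<Longrightarrow> y \<sqsubseteq> z \<longleftrightarrow> f y \<subseteq> f z"
  using simplicial assms unfolding simplicial_poset_def At_def under_def by blast

text \<open>The isomorphism in the definition of a simplicial poset is arbitrary; it permutes the atoms,
  and undoing this permutation shows that \<^const>\<open>At\<close> is an isomorphism, too.\<close>

lemma
  assumes u: "u \<in> S"
  shows below_iff_At: "\<And>y z. y \<sqsubseteq> u \<Longrightarrow> z \<sqsubseteq> u \<Longrightarrow> y \<sqsubseteq> z \<longleftrightarrow> At y \<subseteq> At z"
    and ex_At: "\<And>B. B \<subseteq> At u \<Longrightarrow> \<exists>y. y \<sqsubseteq> u \<and> At y = B"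
proof -
  obtain f where bij: "bij_betw f (under r u) (Pow (At u))"
    and iso: "\<And>y z. y \<sqsubseteq> u \<Longrightarrow> z \<sqsubseteq> u \<Longrightarrow> y \<sqsubseteq> z \<longleftrightarrow> f y \<subseteq> f z"
    using Boolean_interval[OF u] by blast
  have sub: "f y \<subseteq> At u" if "y \<sqsubseteq> u" for y
    using bij_betwE[OF bij] that by (auto simp: under_def)
  have surj: "\<exists>y. y \<sqsubseteq> u \<and> f y = B" if "B \<subseteq> At u" for B
  proof -
    have "B \<in> f ` under r u" using bij that by (simp add: bij_betw_def)
    then show ?thesis by (auto simp: under_def)
  qed
  have inj: "y = z" if "y \<sqsubseteq> u" "z \<sqsubseteq> u" "f y = f z" for y z
    using iso that below_antisym by blast
  have min_iff: "is_minimum r y \<longleftrightarrow> f y = {}" if y: "y \<sqsubseteq> u" for y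
  proof
    assume "is_minimum r y"
    moreover obtain e where "e \<sqsubseteq> u" "f e = {}" using surj[of "{}"] by auto
    ultimately show "f y = {}"
      using iso[OF y] below_carrier unfolding is_minimum_def Field_eq by blast
  next
    \<comment> \<open>The minimum of the poset lies below \<open>y\<close>, so \<open>f\<close>
      sends it into \<open>f y\<close> and hence to the empty set; injectivity identifies it with
      \<open>y\<close>.\<close>
    assume 0: "f y = {}"
    obtain z where z: "z \<in> S" "\<And>x. x \<in> S \<Longrightarrow> z \<sqsubseteq> x" using obtain_minimum by blast
    have zu: "z \<sqsubseteq> u" "z \<sqsubseteq> y" using z u y below_carrier by auto
    then have "f z = {}" using iso 0 y by auto
    then have "y = z" using inj zu y 0 by auto
    then show "is_minimum r y" using z unfolding is_minimum_def Field_eq by blast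
  qed
  have atomI: "y \<in> atoms r" if y: "y \<sqsubseteq> u" "f y = {b}" for y b
    unfolding atoms_def minimal_elems_def Field_eq
  proof (intro CollectI conjI ballI impI)
    show "y \<in> S" using y below_carrier by blast
    show "\<not> is_minimum r y" using min_iff y by simp
    fix w assume w: "w \<in> {x \<in> S. \<not> is_minimum r x}" "w \<sqsubseteq> y"
    have wu: "w \<sqsubseteq> u" using w y below_trans by blast
    then have "f w \<noteq> {}" "f w \<subseteq> {b}" using w y min_iff iso[of w y] by auto
    then show "w = y" using inj[OF wu y(1)] y by auto
  qed
  \<comment> \<open>For \<open>b\<close> in \<open>f a\<close>, the preimage of \<open>{b}\<close>
    lies below \<open>a\<close> and is not the minimum, so it must be the atom \<open>a\<close>
    itself.\<close>
  have "\<exists>b\<in>At u. f a = {b}" if a: "a \<in> At u" for a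
  proof -
    have au: "a \<sqsubseteq> u" using a by (simp add: mem_At)
    have "\<not> is_minimum r a"
      using a unfolding mem_At atoms_def minimal_elems_def by blast
    then obtain b where b: "b \<in> f a" using min_iff au by blast
    then have bu: "b \<in> At u" using sub au by blast
    then obtain w where w: "w \<sqsubseteq> u" "f w = {b}" using surj[of "{b}"] by auto
    have "w \<sqsubseteq> a" using iso[OF w(1) au] w b by simp
    moreover have "\<not> is_minimum r w" using min_iff w by simp
    ultimately have "w = a"
      using a below_carrier unfolding mem_At atoms_def minimal_elems_def Field_eq by blast
    then show ?thesis using w bu by auto
  qed
  then obtain g where g: "\<And>a. a \<in> At u \<Longrightarrow> f a = {g a} \<and> g a \<in> At u" by metis
  have g_surj: "\<exists>a\<in>At u. g a = b" if b: "b \<in> At u" for b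
  proof -
    obtain w where w: "w \<sqsubseteq> u" "f w = {b}" using surj[of "{b}"] b by auto
    then have "w \<in> At u" using atomI by (simp add: mem_At)
    then show ?thesis using g[of w] w by auto
  qed
  have g_inj: "a = b" if "a \<in> At u" "b \<in> At u" "g a = g b" for a b
    using that g inj[of a b] by (simp add: mem_At)
  have At_iff: "a \<in> At y \<longleftrightarrow> a \<in> At u \<and> g a \<in> f y" if y: "y \<sqsubseteq> u" for a y
  proof -
    have "a \<in> At u \<Longrightarrow> a \<sqsubseteq> y \<longleftrightarrow> g a \<in> f y"
      using iso[of a y] y g[of a] by (simp add: mem_At)
    then show ?thesis using y below_trans by (auto simp: mem_At)
  qed
  show "y \<sqsubseteq> z \<longleftrightarrow> At y \<subseteq> At z" if yz: "y \<sqsubseteq> u" "z \<sqsubseteq> u" for y z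
  proof
    assume "At y \<subseteq> At z"
    then have "f y \<subseteq> f z" using At_iff yz sub[OF yz(1)] g_surj by blast
    then show "y \<sqsubseteq> z" using iso yz by simp
  qed (rule At_mono)
  show "\<exists>y. y \<sqsubseteq> u \<and> At y = B" if B: "B \<subseteq> At u" for B
  proof -
    \<comment> \<open>By \<open>At_iff\<close>, \<open>At y\<close> is the preimage of
      \<open>f y\<close> under the injective map \<open>g\<close>; this dictates the choice of
      \<open>f y\<close> as the image of \<open>B\<close>.\<close>
    obtain y where y: "y \<sqsubseteq> u" "f y = g ` B" using surj[of "g ` B"] B g by auto
    have "At y = B" using At_iff[OF y(1)] y(2) B g_inj by blast
    then show ?thesis using y by blast
  qed
qed

text \<open>The common upper bound is essential: two elements without one may have the same atoms,
  like two edges joining the same pair of vertices.\<close>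

lemma At_inj: "x \<sqsubseteq> u \<Longrightarrow> y \<sqsubseteq> u \<Longrightarrow> At x = At y \<Longrightarrow> x = y"
  using below_iff_At[of u x y] below_iff_At[of u y x] below_antisym below_carrier by auto

section \<open>The rank as the number of atoms below\<close>

lemma card_At_less: "x \<sqsubseteq> y \<Longrightarrow> x \<noteq> y \<Longrightarrow> card (At x) < card (At y)"
  using At_inj[of x y y] At_mono[of x y] below_refl below_carrier
  by (intro psubset_card_mono) (auto simp: finite_At)

text \<open>Along a chain the number of atoms is strictly increasing, so it takes distinct values
  between 0 and \<open>card (At x)\<close>.\<close>

lemma card_chain_le:
  assumes x: "x \<in> S" and C: "C \<in> Chains r" "C \<subseteq> under r x"
  shows "card C \<le> card (At x) + 1"
proof -
  have "inj_on (\<lambda>y. card (At y)) C"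
  proof (rule inj_onI, rule ccontr)
    fix y z assume "y \<in> C" "z \<in> C" "card (At y) = card (At z)" "y \<noteq> z"
    then show False
      using C(1) card_At_less[of y z] card_At_less[of z y] unfolding Chains_def by auto
  qed
  moreover have "(\<lambda>y. card (At y)) ` C \<subseteq> {..card (At x)}"
    using C(2) At_mono by (auto simp: under_def intro!: card_mono finite_At)
  ultimately have "card C \<le> card {..card (At x)}" by (intro card_inj_on_le) auto
  then show ?thesis by simp
qed

text \<open>Such a chain arises by descending from \<open>x\<close>, removing one atom at a
  time.\<close>

lemma ex_chain:
  assumes "x \<in> S"
  shows "\<exists>C\<in>Chains r. C \<subseteq> under r x \<and> card C = card (At x) + 1"
  using assms
proof (induction "card (At x)" arbitrary: x)
  case 0
  then show ?case
    using below_refl by (intro bexI[of _ "{x}"]) (auto simp: under_def Chains_def)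
next
  case (Suc n)
  then obtain a where a: "a \<in> At x" by (metis all_not_in_conv card.empty nat.distinct(1))
  obtain y where y: "y \<sqsubseteq> x" "At y = At x - {a}" using ex_At[of x "At x - {a}"] Suc by auto
  have cy: "card (At y) = n" using y Suc.hyps(2) a finite_At by simp
  then obtain C where C: "C \<in> Chains r" "C \<subseteq> under r y" "card C = n + 1"
    using Suc.hyps(1)[of y] y below_carrier by auto
  have "\<not> x \<sqsubseteq> y" using At_mono[of x y] y a by auto
  then have "x \<notin> C" using C(2) by (auto simp: under_def)
  moreover have "finite C" using C(2) finite_under finite_subset by blast
  ultimately have "card (insert x C) = card (At x) + 1" using C(3) Suc.hyps(2) by simp
  moreover have Cx: "\<forall>c\<in>C. c \<sqsubseteq> x" using C(2) y below_trans by (auto simp: under_def)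
  moreover have "insert x C \<in> Chains r"
    using Cx C(1) below_refl[OF Suc.prems] unfolding Chains_def by blast
  ultimately show ?case
    using below_refl[OF Suc.prems] by (intro bexI[of _ "insert x C"]) (auto simp: under_def)
qed

text \<open>A chain that attains the bound of \<open>card_chain_le\<close> is maximal, and
  \<open>ex_chain\<close> provides one. The \<open>- 1\<close> in \<open>rank\<close> cancels the
  extra element of the chain.\<close>

lemma rank_eq:
  assumes x: "x \<in> S"
  shows "rank r x = card (At x)"
proof -
  let ?M = "maximal_chains r (under r x)"
  obtain C where C: "C \<in> Chains r" "C \<subseteq> under r x" "card C = card (At x) + 1"
    using ex_chain[OF x] by blast
  have "C \<in> ?M"
    unfolding maximal_chains_def
  proof (intro CollectI conjI ballI impI)
    fix D assume D: "D \<in> Chains r" "D \<subseteq> under r x \<and> C \<subseteq> D"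
    then have "finite D" using finite_under finite_subset by blast
    moreover have "card D \<le> card C" using card_chain_le[OF x] D C(3) by simp
    ultimately show "D = C" using D card_seteq by blast
  qed (use C in auto)
  moreover have "finite ?M"
    by (rule finite_subset[of _ "Pow (under r x)"]) (auto simp: maximal_chains_def finite_under)
  moreover have "card D \<le> card (At x) + 1" if "D \<in> ?M" for D
    using that card_chain_le[OF x] by (auto simp: maximal_chains_def)
  ultimately have "Max (card ` ?M) = card (At x) + 1"
    using C(3) by (intro Max_eqI) (auto intro: rev_image_eqI)
  then show ?thesis by (simp add: rank_def)
qed

section \<open>Joins and meets in terms of atom sets\<close>

lemma mem_joins: "u \<in> joins r x y \<longleftrightarrow> x \<sqsubseteq> u \<and> y \<sqsubseteq> u \<and> At u = At x \<union> At y"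
proof
  assume u: "u \<in> joins r x y"
  then have xu: "x \<sqsubseteq> u" "y \<sqsubseteq> u"
    and min: "\<And>v. x \<sqsubseteq> v \<Longrightarrow> y \<sqsubseteq> v \<Longrightarrow> v \<sqsubseteq> u \<Longrightarrow> v = u"
    using below_carrier unfolding joins_def minimal_elems_def Above_def Field_eq by auto
  have uS: "u \<in> S" using xu below_carrier by blast
  \<comment> \<open>The Boolean interval below \<open>u\<close> contains the union of the atom sets
    as an upper bound \<open>v\<close>; minimality of \<open>u\<close> forces
    \<open>v = u\<close>.\<close>
  obtain v where v: "v \<sqsubseteq> u" "At v = At x \<union> At y"
    using ex_At[OF uS, of "At x \<union> At y"] At_mono xu by auto
  have "x \<sqsubseteq> v" "y \<sqsubseteq> v" using below_iff_At[OF uS] xu v by auto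
  then show "x \<sqsubseteq> u \<and> y \<sqsubseteq> u \<and> At u = At x \<union> At y" using min v xu by auto
next
  assume *: "x \<sqsubseteq> u \<and> y \<sqsubseteq> u \<and> At u = At x \<union> At y"
  then have uS: "u \<in> S" using below_carrier by blast
  have "v = u" if "x \<sqsubseteq> v" "y \<sqsubseteq> v" "v \<sqsubseteq> u" for v
    using At_inj[of v u u] that below_refl[OF uS] At_mono[of x v] At_mono[of y v] At_mono[of v u] *
    by auto
  then show "u \<in> joins r x y"
    using * uS unfolding joins_def minimal_elems_def Above_def Field_eq by auto
qed

text \<open>This turns any common upper bound into a proof that the set of joins is nonempty, and
  keeps the join inside a given interval.\<close>

lemma ex_join_below:
  assumes "x \<sqsubseteq> u" "y \<sqsubseteq> u"
  shows "\<exists>v\<in>joins r x y. v \<sqsubseteq> u"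
proof -
  have uS: "u \<in> S" using assms below_carrier by blast
  obtain v where v: "v \<sqsubseteq> u" "At v = At x \<union> At y"
    using ex_At[OF uS, of "At x \<union> At y"] At_mono assms by auto
  then have "x \<sqsubseteq> v" "y \<sqsubseteq> v" using below_iff_At[OF uS] assms by auto
  then show ?thesis using v mem_joins by blast
qed

lemma mem_meets:
  "l \<in> meets r x y \<longleftrightarrow> l \<sqsubseteq> x \<and> l \<sqsubseteq> y \<and> (\<forall>w. w \<sqsubseteq> x \<and> w \<sqsubseteq> y \<and> l \<sqsubseteq> w \<longrightarrow> w = l)"
  using below_carrier unfolding meets_def maximal_elems_def Under_def Field_eq by auto

lemma the_meet_eq:
  assumes "u \<in> joins r x y" "m \<in> meets r x y"
  shows "the_elem (meets r x y) = m"
  using meets_singleton[OF simplicial, of x y] assms by (metis empty_iff singletonD the_elem_eq)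

text \<open>A join puts \<open>x\<close> and \<open>y\<close> into one Boolean interval, where the
  intersection of their atom sets is realised by an element.\<close>

lemma the_meet:
  assumes "u \<in> joins r x y"
  shows "the_elem (meets r x y) \<sqsubseteq> x" "the_elem (meets r x y) \<sqsubseteq> y"
    "At (the_elem (meets r x y)) = At x \<inter> At y"
proof -
  have xu: "x \<sqsubseteq> u" "y \<sqsubseteq> u" using assms mem_joins by auto
  then have uS: "u \<in> S" using below_carrier by blast
  obtain m where m: "m \<sqsubseteq> u" "At m = At x \<inter> At y"
    using ex_At[OF uS, of "At x \<inter> At y"] At_mono xu by blast
  have mx: "m \<sqsubseteq> x" "m \<sqsubseteq> y" using below_iff_At[OF uS] xu m by auto
  have "w = m" if w: "w \<sqsubseteq> x" "w \<sqsubseteq> y" "m \<sqsubseteq> w" for w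
  proof -
    have "At w = At m" using At_mono[OF w(1)] At_mono[OF w(2)] At_mono[OF w(3)] m(2) by blast
    then show ?thesis using At_inj[OF below_trans[OF w(1) xu(1)] m(1)] by blast
  qed
  then have "m \<in> meets r x y" using mx mem_meets by blast
  then have "the_elem (meets r x y) = m" using the_meet_eq assms by blast
  then show "the_elem (meets r x y) \<sqsubseteq> x" "the_elem (meets r x y) \<sqsubseteq> y"
    "At (the_elem (meets r x y)) = At x \<inter> At y"
    using mx m by auto
qed

text \<open>An element of \<open>P\<close> above \<open>x\<close> with the largest number of atoms
  is maximal, by \<open>card_At_less\<close>.\<close>

lemma ex_maximal_above:
  assumes "P \<subseteq> S" "x \<in> P"
  shows "\<exists>z\<in>maximal_elems r P. x \<sqsubseteq> z"
proof -
  let ?Q = "{w \<in> P. x \<sqsubseteq> w}"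
  have fin: "finite ?Q" using assms(1) finite_carrier finite_subset by fastforce
  have ne: "x \<in> ?Q" using assms below_refl by auto
  have "Max ((\<lambda>w. card (At w)) ` ?Q) \<in> (\<lambda>w. card (At w)) ` ?Q"
    using fin ne by (intro Max_in) auto
  then obtain z where z: "z \<in> ?Q" "Max ((\<lambda>w. card (At w)) ` ?Q) = card (At z)" by auto
  have "w = z" if "w \<in> P" "z \<sqsubseteq> w" for w
  proof (rule ccontr)
    assume "w \<noteq> z"
    then have "card (At z) < card (At w)" using card_At_less that by blast
    moreover have "w \<in> ?Q" using that z below_trans by auto
    ultimately show False using z(2) fin by (metis (no_types, lifting) Max_ge finite_imageI
      imageI not_le)
  qed
  then show ?thesis using z unfolding maximal_elems_def by blast
qed

lemma mem_maximal_under: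
  "z \<in> maximal_elems r (I \<inter> under r x) \<longleftrightarrow>
    z \<in> I \<and> z \<sqsubseteq> x \<and> (\<forall>w\<in>I. w \<sqsubseteq> x \<and> z \<sqsubseteq> w \<longrightarrow> w = z)"
  by (auto simp: maximal_elems_def under_def)

section \<open>From a matroid scheme to (I1)-(I4)\<close>

context
  fixes \<rho> :: "'a \<Rightarrow> nat"
  assumes scheme: "matroid_scheme S r \<rho>"
begin

lemma scheme_le_card: "x \<in> S \<Longrightarrow> \<rho> x \<le> card (At x)"
  using scheme rank_eq unfolding matroid_scheme_def by metis

lemma scheme_mono: "x \<sqsubseteq> y \<Longrightarrow> \<rho> x \<le> \<rho> y"
  using scheme below_carrier unfolding matroid_scheme_def by metis

lemma scheme_submodular:
  "u \<in> joins r x y \<Longrightarrow> \<rho> u + \<rho> (the_elem (meets r x y)) \<le> \<rho> x + \<rho> y"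
  using scheme below_carrier mem_joins unfolding matroid_scheme_def by metis

lemma scheme_joins: "l \<in> meets r x y \<Longrightarrow> \<rho> x = \<rho> l \<Longrightarrow> joins r x y \<noteq> {}"
  using scheme below_carrier mem_meets unfolding matroid_scheme_def by metis

lemma scheme_augment:
  "x \<in> S \<Longrightarrow> y \<in> S \<Longrightarrow> \<rho> x < \<rho> y \<Longrightarrow> \<exists>a\<in>atoms r. a \<sqsubseteq> y \<and> \<not> a \<sqsubseteq> x \<and> joins r x a \<noteq> {}"
  using scheme unfolding matroid_scheme_def by blast

lemma mem_independence: "x \<in> independence_poset S r \<rho> \<longleftrightarrow> x \<in> S \<and> \<rho> x = card (At x)"
  using rank_eq by (auto simp: independence_poset_def)

text \<open>The minimum is independent: it has no atoms below it, so (M1) forces its value to be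
  0.\<close>

lemma independence_nonempty: "independence_poset S r \<rho> \<noteq> {}"
proof -
  obtain z where z: "z \<in> S" "\<And>x. x \<in> S \<Longrightarrow> z \<sqsubseteq> x" using obtain_minimum by blast
  then have "is_minimum r z" by (simp add: is_minimum_def Field_eq)
  have "At z = {}"
  proof (rule ccontr)
    assume "At z \<noteq> {}"
    then obtain a where a: "a \<in> atoms r" "a \<sqsubseteq> z" by (auto simp: mem_At)
    then have "a = z" using z below_antisym below_carrier by blast
    then show False
      using a \<open>is_minimum r z\<close> by (simp add: atoms_def minimal_elems_def)
  qed
  then have "\<rho> z = card (At z)" using scheme_le_card[OF z(1)] by simp
  then show ?thesis using mem_independence z(1) by blast
qed

text \<open>Let \<open>x'\<close> be the complement of \<open>x\<close> in the interval below
  \<open>y\<close>. By (M3) the values of \<open>x\<close> and \<open>x'\<close> add up to at least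
  \<open>card (At y)\<close>, which by (M1) is also the most they can reach; so both bounds are
  attained.\<close>

lemma independence_down:
  assumes "x \<sqsubseteq> y" and y: "y \<in> independence_poset S r \<rho>"
  shows "x \<in> independence_poset S r \<rho>"
proof -
  have yS: "y \<in> S" and xS: "x \<in> S" using assms below_carrier by auto
  obtain x' where x': "x' \<sqsubseteq> y" "At x' = At y - At x" using ex_At[OF yS, of "At y - At x"] by blast
  have sub: "At x \<subseteq> At y" using assms At_mono by blast
  then have "y \<in> joins r x x'" using mem_joins assms x' by auto
  then have "\<rho> y \<le> \<rho> x + \<rho> x'" using scheme_submodular by fastforce
  moreover have "\<rho> y = card (At y)" using y mem_independence by blast
  moreover have "\<rho> x \<le> card (At x)" "\<rho> x' \<le> card (At y) - card (At x)"
    using scheme_le_card[OF xS] scheme_le_card[of x'] x' below_carrier card_Diff_subset[OF finite_At sub]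
    by auto
  moreover have "card (At x) \<le> card (At y)" using sub finite_At card_mono by blast
  ultimately show ?thesis using xS mem_independence by auto
qed

lemma independence_augment:
  assumes x: "x \<in> independence_poset S r \<rho>" and y: "y \<in> independence_poset S r \<rho>"
    and less: "card (At x) < card (At y)"
  shows "\<exists>a\<in>atoms r. a \<sqsubseteq> y \<and> \<not> a \<sqsubseteq> x \<and>
    joins r a x \<noteq> {} \<and> joins r a x \<subseteq> independence_poset S r \<rho>"
proof -
  let ?P = "{w \<in> S. \<rho> w = \<rho> x}"
  have xS: "x \<in> S" "\<rho> x = card (At x)" and yS: "y \<in> S" "\<rho> y = card (At y)"
    using x y mem_independence by auto
  obtain x' where x': "x' \<in> maximal_elems r ?P" "x \<sqsubseteq> x'" using ex_maximal_above[of ?P x] xS by auto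
  then have x'S: "x' \<in> S" "\<rho> x' = \<rho> x"
    and max: "\<And>t. x' \<sqsubseteq> t \<Longrightarrow> \<rho> t = \<rho> x \<Longrightarrow> t = x'"
    using below_carrier unfolding maximal_elems_def by auto
  obtain a where a: "a \<in> atoms r" "a \<sqsubseteq> y" "\<not> a \<sqsubseteq> x'" "joins r x' a \<noteq> {}"
    using scheme_augment[of x' y] x'S yS xS less by auto
  have ax: "\<not> a \<sqsubseteq> x" using a x' below_trans by blast
  obtain u where "u \<in> joins r x' a" using a by blast
  then have "x \<sqsubseteq> u" "a \<sqsubseteq> u" using mem_joins x' below_trans by blast+
  then have "joins r a x \<noteq> {}" using ex_join_below[of a u x] by blast
  moreover have "v \<in> independence_poset S r \<rho>" if v: "v \<in> joins r a x" for v
  proof -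
    have v': "x \<sqsubseteq> v" "a \<sqsubseteq> v" "v \<in> S" "At v = insert a (At x)"
      using v mem_joins At_atom[OF a(1)] below_carrier by auto
    have card: "card (At v) = Suc (card (At x))" using v' ax finite_At by (simp add: mem_At)
    have "\<rho> v \<noteq> \<rho> x"
    proof
      assume eq: "\<rho> v = \<rho> x"
      \<comment> \<open>The only atom of \<open>v\<close> outside \<open>x\<close> is
        \<open>a\<close>, and \<open>a\<close> is not below \<open>x'\<close>. So \<open>x\<close>
        is a maximal common lower bound of \<open>v\<close> and \<open>x'\<close>, as (M4)
        requires.\<close>
      have "w = x" if w: "w \<sqsubseteq> v" "w \<sqsubseteq> x'" "x \<sqsubseteq> w" for w
      proof -
        have "a \<notin> At w" using w a below_trans by (auto simp: mem_At)
        then have "At w = At x" using At_mono[OF w(1)] At_mono[OF w(3)] v' by auto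
        then show "w = x" using At_inj[of w v x] w v' by blast
      qed
      then have m: "x \<in> meets r v x'" using mem_meets v' x' by blast
      then obtain t where t: "t \<in> joins r v x'" using scheme_joins eq by blast
      \<comment> \<open>Since \<open>v\<close>, \<open>x'\<close> and their meet \<open>x\<close>
        all have the value of \<open>x\<close>, (M3) keeps the join \<open>t\<close> at that value.
        Maximality of \<open>x'\<close> then gives \<open>t = x'\<close>, which puts
        \<open>a\<close> below \<open>x'\<close>.\<close>
      have "\<rho> t \<le> \<rho> x" using scheme_submodular[OF t] the_meet_eq[OF t m] eq x'S by simp
      moreover have t': "x' \<sqsubseteq> t" "v \<sqsubseteq> t" using t mem_joins by auto
      ultimately have "t = x'" using max[of t] scheme_mono[of x' t] x'S by auto
      then show False using t' v' a below_trans by blast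
    qed
    then have "\<rho> v = card (At v)"
      using scheme_mono[OF v'(1)] scheme_le_card[OF v'(3)] card xS by linarith
    then show ?thesis using mem_independence v' by blast
  qed
  ultimately show ?thesis using a ax by blast
qed

text \<open>This is the closure argument for matroids: take a maximal \<open>w\<close> between
  \<open>z\<close> and \<open>x\<close> with the value of \<open>z\<close>, and show that no atom of
  \<open>x\<close> is missing from \<open>w\<close>.\<close>

lemma maximal_independent_rank:
  assumes z: "z \<in> maximal_elems r (independence_poset S r \<rho> \<inter> under r x)"
  shows "\<rho> z = \<rho> x"
proof -
  let ?P = "{w \<in> under r x. z \<sqsubseteq> w \<and> \<rho> w = \<rho> z}"
  have zI: "z \<in> independence_poset S r \<rho>" "z \<sqsubseteq> x"
    and max: "\<And>w. w \<in> independence_poset S r \<rho> \<Longrightarrow> w \<sqsubseteq> x \<Longrightarrow> z \<sqsubseteq> w \<Longrightarrow> w = z"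
    using z unfolding mem_maximal_under by auto
  have zS: "z \<in> S" "\<rho> z = card (At z)" using zI mem_independence by auto
  have xS: "x \<in> S" using zI below_carrier by blast
  have "?P \<subseteq> S" "z \<in> ?P" using below_carrier zI below_refl[OF zS(1)] by (auto simp: under_def)
  then obtain w where w: "w \<in> maximal_elems r ?P" using ex_maximal_above by blast
  then have w': "w \<sqsubseteq> x" "z \<sqsubseteq> w" "\<rho> w = \<rho> z"
    and wmax: "\<And>t. t \<sqsubseteq> x \<Longrightarrow> w \<sqsubseteq> t \<Longrightarrow> \<rho> t = \<rho> z \<Longrightarrow> t = w"
    using below_trans unfolding maximal_elems_def under_def by auto
  have "At x \<subseteq> At w"
  proof (rule ccontr)
    assume "\<not> At x \<subseteq> At w"
    then obtain a where "a \<in> At x" and aw: "a \<notin> At w" by blast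
    then have a: "a \<in> atoms r" "a \<sqsubseteq> x" by (simp_all add: mem_At)
    have az: "a \<notin> At z" using aw At_mono[OF w'(2)] by blast
    obtain v where v: "v \<in> joins r z a" "v \<sqsubseteq> x" using ex_join_below[OF zI(2) a(2)] by blast
    then have v': "z \<sqsubseteq> v" "v \<in> S" "At v = insert a (At z)"
      using mem_joins At_atom[OF a(1)] below_carrier by auto
    have "v \<noteq> z" using v' az by auto
    \<comment> \<open>By maximality of \<open>z\<close>, the larger \<open>v\<close> is dependent.
      It has just one atom more than \<open>z\<close>, so its value stays that of
      \<open>z\<close>.\<close>
    then have "\<rho> v \<noteq> card (At v)" using max[of v] v v' mem_independence by blast
    then have rv: "\<rho> v = \<rho> z"
      using scheme_mono[OF v'(1)] scheme_le_card[OF v'(2)] v'(3) az zS finite_At[of z] by simp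
    obtain t where t: "t \<in> joins r w v" "t \<sqsubseteq> x" using ex_join_below[OF w'(1) v(2)] by blast
    \<comment> \<open>With meet \<open>z\<close>, (M3) shows that joining \<open>v\<close> to
      \<open>w\<close> does not raise the value, against the maximality of \<open>w\<close>.\<close>
    have "At w \<inter> At v = At z" using v' aw At_mono[OF w'(2)] by auto
    then have "the_elem (meets r w v) = z"
      using the_meet[OF t(1)] At_inj[of "the_elem (meets r w v)" w z] w' by auto
    then have "\<rho> t \<le> \<rho> z" using scheme_submodular[OF t(1)] rv w' by simp
    moreover have wt: "w \<sqsubseteq> t" "At t = At w \<union> At v" using t mem_joins by auto
    ultimately have "t = w" using wmax[OF t(2)] scheme_mono[of w t] w' by auto
    then show False using wt v' aw by auto
  qed
  then have "w = x" using below_iff_At[OF xS, of x w] w' below_refl[OF xS] below_antisym by auto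
  then show ?thesis using w' by simp
qed

text \<open>Above \<open>z\<close> there is a maximal common lower bound \<open>l\<close> of
  \<open>x\<close> and \<open>y\<close>. Its value lies between those of \<open>z\<close> and
  \<open>x\<close>, which agree, so (M4) applies.\<close>

lemma independence_joins:
  assumes z: "z \<in> maximal_elems r (independence_poset S r \<rho> \<inter> under r x)" and zy: "z \<sqsubseteq> y"
  shows "joins r x y \<noteq> {}"
proof -
  have zx: "z \<sqsubseteq> x" using z unfolding mem_maximal_under by auto
  have "z \<in> Under r {x, y}" "Under r {x, y} \<subseteq> S"
    using zx zy below_carrier by (auto simp: Under_def Field_eq)
  then obtain l where l: "l \<in> meets r x y" "z \<sqsubseteq> l"
    using ex_maximal_above unfolding meets_def by blast
  have "\<rho> z \<le> \<rho> l" "\<rho> l \<le> \<rho> x" using l scheme_mono mem_meets by blast+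
  then have "\<rho> x = \<rho> l" using maximal_independent_rank[OF z] by simp
  then show ?thesis using scheme_joins l by blast
qed

end

section \<open>From (I1)-(I4) to a matroid scheme: the rank function of \<open>I\<close>\<close>

definition independence_rank :: "'a set \<Rightarrow> 'a \<Rightarrow> nat"
  where "independence_rank I x = Max ((\<lambda>z. card (At z)) ` (I \<inter> under r x))"

context
  fixes I :: "'a set"
  assumes sub: "I \<subseteq> S" and nonempty: "I \<noteq> {}"
    and down: "\<And>x y. x \<sqsubseteq> y \<Longrightarrow> y \<in> I \<Longrightarrow> x \<in> I"
    and augment: "\<And>x y. x \<in> I \<Longrightarrow> y \<in> I \<Longrightarrow> card (At x) < card (At y) \<Longrightarrow>
      \<exists>a\<in>atoms r. a \<sqsubseteq> y \<and> \<not> a \<sqsubseteq> x \<and> joins r a x \<noteq> {} \<and> joins r a x \<subseteq> I"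
    and join: "\<And>x y z. z \<in> maximal_elems r (I \<inter> under r x) \<Longrightarrow> z \<sqsubseteq> y \<Longrightarrow> joins r x y \<noteq> {}"
begin

lemma card_le_independence_rank: "z \<in> I \<Longrightarrow> z \<sqsubseteq> x \<Longrightarrow> card (At z) \<le> independence_rank I x"
  unfolding independence_rank_def using finite_under by (intro Max_ge) (auto simp: under_def)

lemma minimum_mem: assumes "x \<in> S" shows "\<exists>z\<in>I. z \<sqsubseteq> x"
  using nonempty sub obtain_minimum down assms by (metis subsetD ex_in_conv)

lemma ex_basis:
  assumes "x \<in> S"
  shows "\<exists>z\<in>I. z \<sqsubseteq> x \<and> card (At z) = independence_rank I x"
proof -
  \<comment> \<open>The minimum of the poset lies in \<open>I\<close>, so the \<open>Max\<close> in
    \<open>independence_rank\<close> ranges over a nonempty set.\<close>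
  have "I \<inter> under r x \<noteq> {}" using minimum_mem[OF assms] by (auto simp: under_def)
  then have "independence_rank I x \<in> (\<lambda>z. card (At z)) ` (I \<inter> under r x)"
    unfolding independence_rank_def using finite_under by (intro Max_in) auto
  then show ?thesis by (auto simp: under_def)
qed

text \<open>Some join of \<open>a\<close> and \<open>z\<close> stays below \<open>x\<close>; it lies
  in \<open>I\<close>, so by maximality it is \<open>z\<close>. Hence an atom that augments
  \<open>z\<close> as in (I3) is never below \<open>x\<close>.\<close>

lemma augment_below:
  assumes z: "z \<in> maximal_elems r (I \<inter> under r x)" and a: "joins r a z \<subseteq> I" "a \<sqsubseteq> x"
  shows "a \<sqsubseteq> z"
proof -
  have z': "z \<sqsubseteq> x" "\<And>w. w \<in> I \<Longrightarrow> w \<sqsubseteq> x \<Longrightarrow> z \<sqsubseteq> w \<Longrightarrow> w = z"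
    using z unfolding mem_maximal_under by auto
  obtain v where v: "v \<in> joins r a z" "v \<sqsubseteq> x" using ex_join_below[OF a(2) z'(1)] by blast
  then show ?thesis using z'(2)[of v] a(1) mem_joins by blast
qed

text \<open>If a maximal \<open>z\<close> were smaller than a largest independent \<open>b\<close>
  below \<open>x\<close>, (I3) would augment it by an atom below \<open>b\<close>, hence below
  \<open>x\<close>, contrary to \<open>augment_below\<close>.\<close>

lemma maximal_iff_basis:
  "z \<in> maximal_elems r (I \<inter> under r x) \<longleftrightarrow>
    z \<in> I \<and> z \<sqsubseteq> x \<and> card (At z) = independence_rank I x"
proof (intro iffI)
  assume z: "z \<in> maximal_elems r (I \<inter> under r x)"
  then have z': "z \<in> I" "z \<sqsubseteq> x" unfolding mem_maximal_under by auto
  obtain b where b: "b \<in> I" "b \<sqsubseteq> x" "card (At b) = independence_rank I x"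
    using ex_basis[of x] z' below_carrier by blast
  have "\<not> card (At z) < card (At b)"
    using augment[OF z'(1) b(1)] augment_below[OF z] b(2) below_trans by blast
  then show "z \<in> I \<and> z \<sqsubseteq> x \<and> card (At z) = independence_rank I x"
    using card_le_independence_rank z' b by fastforce
next
  assume z: "z \<in> I \<and> z \<sqsubseteq> x \<and> card (At z) = independence_rank I x"
  then have "w = z" if "w \<in> I" "w \<sqsubseteq> x" "z \<sqsubseteq> w" for w
    using that card_At_less[of z w] card_le_independence_rank[of w x] by fastforce
  then show "z \<in> maximal_elems r (I \<inter> under r x)" using z mem_maximal_under by blast
qed

lemma independence_rank_mono:
  assumes "x \<sqsubseteq> y"
  shows "independence_rank I x \<le> independence_rank I y"
  using ex_basis[of x] card_le_independence_rank[of _ y] assms below_trans below_carrier by metis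

lemma independence_rank_le: assumes "x \<in> S" shows "independence_rank I x \<le> card (At x)"
  using ex_basis[OF assms] At_mono finite_At card_mono by metis

text \<open>Extend a basis \<open>p\<close> of the meet to a basis \<open>q\<close> of
  \<open>u\<close>. The atoms of \<open>q\<close> in \<open>x\<close> and those in \<open>y\<close>
  cover \<open>q\<close> and overlap in at least \<open>At p\<close>.\<close>

lemma independence_rank_submodular:
  assumes u: "u \<in> joins r x y"
  shows "independence_rank I u + independence_rank I (the_elem (meets r x y))
    \<le> independence_rank I x + independence_rank I y"
proof -
  define m where "m = the_elem (meets r x y)"
  have m: "m \<sqsubseteq> x" "m \<sqsubseteq> y" "At m = At x \<inter> At y" using the_meet[OF u] by (auto simp: m_def)
  have xu: "x \<sqsubseteq> u" "y \<sqsubseteq> u" "At u = At x \<union> At y" using u mem_joins by auto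
  have uS: "u \<in> S" using xu below_carrier by blast
  obtain p where p: "p \<in> I" "p \<sqsubseteq> m" "card (At p) = independence_rank I m"
    using ex_basis[of m] m below_carrier by blast
  have "p \<sqsubseteq> u" using p m xu below_trans by blast
  then obtain q where "q \<in> maximal_elems r (I \<inter> under r u)" and pq: "p \<sqsubseteq> q"
    using ex_maximal_above[of "I \<inter> under r u" p] p sub by (auto simp: under_def)
  then have q: "q \<in> I" "q \<sqsubseteq> u" "card (At q) = independence_rank I u"
    using maximal_iff_basis by auto
  \<comment> \<open>By (I2), the part of \<open>q\<close> inside \<open>w\<close> is again
    independent, so the rank of \<open>w\<close> bounds its size.\<close>
  have part: "card (At q \<inter> At w) \<le> independence_rank I w" if w: "w \<sqsubseteq> u" for w
  proof -
    obtain s where s: "s \<sqsubseteq> q" "At s = At q \<inter> At w"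
      using ex_At[of q "At q \<inter> At w"] q below_carrier by blast
    have "s \<sqsubseteq> w" using below_iff_At[OF uS, of s w] s q w below_trans by blast
    then show ?thesis using card_le_independence_rank[of s w] down s q by fastforce
  qed
  have "(At q \<inter> At x) \<union> (At q \<inter> At y) = At q" using At_mono[OF q(2)] xu by blast
  moreover have "(At q \<inter> At x) \<inter> (At q \<inter> At y) = At q \<inter> At m" using m by blast
  ultimately have "card (At q \<inter> At x) + card (At q \<inter> At y) = card (At q) + card (At q \<inter> At m)"
    using card_Un_Int[of "At q \<inter> At x" "At q \<inter> At y"] finite_At by simp
  moreover have "card (At p) \<le> card (At q \<inter> At m)"
    using At_mono[OF p(2)] At_mono[OF pq] finite_At by (intro card_mono) auto
  ultimately show ?thesis
    using part[OF xu(1)] part[OF xu(2)] p q unfolding m_def[symmetric] by linarith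
qed

lemma matroid_scheme_independence_rank: "matroid_scheme S r (independence_rank I)"
proof -
  have M4: "joins r x y \<noteq> {}"
    if l: "l \<in> meets r x y" "independence_rank I x = independence_rank I l" for x y l
  proof -
    have l': "l \<sqsubseteq> x" "l \<sqsubseteq> y" using l mem_meets by auto
    obtain z where z: "z \<in> I" "z \<sqsubseteq> l" "card (At z) = independence_rank I l"
      using ex_basis[of l] l' below_carrier by blast
    \<comment> \<open>As \<open>l\<close> and \<open>x\<close> have equal rank, a basis of
      \<open>l\<close> is also one of \<open>x\<close>; it lies below \<open>y\<close>, so (I4)
      applies.\<close>
    then have "z \<in> maximal_elems r (I \<inter> under r x)"
      using maximal_iff_basis l l' below_trans by auto
    then show ?thesis using join z l' below_trans by blast
  qed
  have M5: "\<exists>a\<in>atoms r. a \<sqsubseteq> y \<and> \<not> a \<sqsubseteq> x \<and> joins r x a \<noteq> {}"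
    if xy: "x \<in> S" "y \<in> S" "independence_rank I x < independence_rank I y" for x y
  proof -
    obtain p where p: "p \<in> I" "p \<sqsubseteq> x" "card (At p) = independence_rank I x"
      using ex_basis xy by blast
    obtain q where q: "q \<in> I" "q \<sqsubseteq> y" "card (At q) = independence_rank I y"
      using ex_basis xy by blast
    obtain a where a: "a \<in> atoms r" "a \<sqsubseteq> q" "\<not> a \<sqsubseteq> p" "joins r a p \<noteq> {}" "joins r a p \<subseteq> I"
      using augment[OF p(1) q(1)] p q xy by auto
    have pmax: "p \<in> maximal_elems r (I \<inter> under r x)" using maximal_iff_basis p by blast
    have "\<not> a \<sqsubseteq> x" using augment_below[OF pmax a(5)] a(3) by blast
    moreover obtain v where v: "v \<in> joins r a p" using a by blast
    \<comment> \<open>The basis \<open>p\<close> of \<open>x\<close> lies below \<open>v\<close>, so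
      (I4) joins \<open>x\<close> with \<open>v\<close>, and this join is above \<open>a\<close>
      too.\<close>
    then obtain t where "t \<in> joins r x v" using join[OF pmax, of v] mem_joins by blast
    then have "x \<sqsubseteq> t" "a \<sqsubseteq> t" using v mem_joins below_trans by blast+
    then have "joins r x a \<noteq> {}" using ex_join_below by blast
    ultimately show ?thesis using a q below_trans by blast
  qed
  show ?thesis
    unfolding matroid_scheme_def
    using independence_rank_le independence_rank_mono independence_rank_submodular M4 M5 rank_eq
    by auto
qed

lemma independence_poset_independence_rank: "independence_poset S r (independence_rank I) = I"
proof (intro equalityI subsetI)
  fix x assume "x \<in> independence_poset S r (independence_rank I)"
  then have x: "x \<in> S" "independence_rank I x = card (At x)"
    using rank_eq by (auto simp: independence_poset_def)
  obtain z where z: "z \<in> I" "z \<sqsubseteq> x" "card (At z) = card (At x)" using ex_basis x by metis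
  \<comment> \<open>A basis of \<open>x\<close> with as many atoms as \<open>x\<close> is
    \<open>x\<close> itself.\<close>
  then have "z = x" using card_At_less by fastforce
  then show "x \<in> I" using z by simp
next
  fix x assume x: "x \<in> I"
  then have "x \<in> S" using sub by blast
  then have "independence_rank I x = card (At x)"
    using card_le_independence_rank[OF x below_refl] independence_rank_le
    by (simp add: order.antisym)
  then show "x \<in> independence_poset S r (independence_rank I)"
    using \<open>x \<in> S\<close> rank_eq by (simp add: independence_poset_def)
qed

end

end

section \<open>The equivalence, with ranks read as numbers of atoms\<close>

theorem theorem6p2:
  fixes S :: "'a set" and r :: "'a rel" and I :: "'a set"
  assumes "finite S" and "simplicial_poset S r" and "I \<subseteq> S"
  shows "(\<exists>\<rho>. matroid_scheme S r \<rho> \<and> I = independence_poset S r \<rho>) \<longleftrightarrow>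
    I \<noteq> {} \<and>
    (\<forall>x\<in>S. \<forall>y\<in>S. (x, y) \<in> r \<and> y \<in> I \<longrightarrow> x \<in> I) \<and>
    (\<forall>x\<in>I. \<forall>y\<in>I. rank r x < rank r y \<longrightarrow>
      (\<exists>a\<in>atoms r. (a, y) \<in> r \<and> (a, x) \<notin> r \<and> joins r a x \<noteq> {} \<and> joins r a x \<subseteq> I)) \<and>
    (\<forall>x\<in>S. \<forall>y\<in>S. \<forall>z\<in>maximal_elems r (I \<inter> under r x). (z, y) \<in> r \<longrightarrow> joins r x y \<noteq> {})"
    (is "?L \<longleftrightarrow> ?I1 \<and> ?I2 \<and> ?I3 \<and> ?I4")
proof -
  interpret finite_simplicial_poset S r using assms by unfold_locales
  show ?thesis
  proof
    assume ?L
    then obtain \<rho> where \<rho>: "matroid_scheme S r \<rho>" and I: "I = independence_poset S r \<rho>" by blast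
    have ?I1 using independence_nonempty[OF \<rho>] I by simp
    moreover have ?I2 using independence_down[OF \<rho>] I by blast
    moreover have ?I3
    proof (intro ballI impI)
      fix x y assume xy: "x \<in> I" "y \<in> I" "rank r x < rank r y"
      then have "card (At x) < card (At y)" using rank_eq assms(3) by (metis subsetD)
      then show "\<exists>a\<in>atoms r. a \<sqsubseteq> y \<and> \<not> a \<sqsubseteq> x \<and> joins r a x \<noteq> {} \<and> joins r a x \<subseteq> I"
        using independence_augment[OF \<rho>] xy I by blast
    qed
    moreover have ?I4 using independence_joins[OF \<rho>] I by blast
    ultimately show "?I1 \<and> ?I2 \<and> ?I3 \<and> ?I4" by blast
  next
    assume R: "?I1 \<and> ?I2 \<and> ?I3 \<and> ?I4"
    have down: "x \<in> I" if "x \<sqsubseteq> y" "y \<in> I" for x y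
      using R that below_carrier by blast
    have augment: "\<exists>a\<in>atoms r. a \<sqsubseteq> y \<and> \<not> a \<sqsubseteq> x \<and> joins r a x \<noteq> {} \<and> joins r a x \<subseteq> I"
      if "x \<in> I" "y \<in> I" "card (At x) < card (At y)" for x y
    proof -
      have "rank r x < rank r y" using that rank_eq assms(3) by (metis subsetD)
      then show ?thesis using R that by blast
    qed
    have join: "joins r x y \<noteq> {}"
      if "z \<in> maximal_elems r (I \<inter> under r x)" "z \<sqsubseteq> y" for x y z
    proof -
      have "x \<in> S" "y \<in> S" using that below_carrier unfolding mem_maximal_under by blast+
      then show ?thesis using R that by blast
    qed
    have I1: ?I1 using R by blast
    have "matroid_scheme S r (independence_rank I)"
      by (rule matroid_scheme_independence_rank) (fact assms(3) I1 down augment join)+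
    moreover have "independence_poset S r (independence_rank I) = I"
      by (rule independence_poset_independence_rank) (fact assms(3) I1 down augment join)+
    ultimately show ?L by blast
  qed
qed

end
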